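(* Let $n\ge 3$, let $a_0,\ldots,a_{n-1}$ be indeterminates over $\mathbb{Q}$, $f=x^n+a_{n-1}x^{n-1}+\cdots+a_0$, \[f_1(x,y)=\frac{f(y)-f(x)}{y-x},\qquad f_3(x,y)=\frac{f(y)-2f\left(\frac{x+y}{2}\right)+f(x)}{\frac{(y-x)^2}{2}},\] and $E=\operatorname{res}(f,\operatorname{res}(f_1,f_3,y),x)\in\mathbb{Q}[a_0,\ldots,a_{n-1}]$. Then the total degree of $E$ in $(a_0,\ldots,a_{n-1})$ equals $3(n-1)(n-2)$.
   Context: $\operatorname{res}$ is the Sylvester resultant with respect to the indicated variable. *)

theory Defs
  imports "HOL-Library.Poly_Mapping" "Subresultants.Resultant_Prelim"
begin

text \<open>The coefficient ring Q[a_0, a_1, ...]: multivariate polynomials over the rationals,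
  represented as finitely supported maps from monomials (exponent vectors nat =>0 nat) to rat.
  The indeterminate a_i is the monomial with exponent vector single i 1.\<close>

type_synonym qmpoly = "(nat \<Rightarrow>\<^sub>0 nat) \<Rightarrow>\<^sub>0 rat"

definition avar :: "nat \<Rightarrow> qmpoly" where
  "avar i = Poly_Mapping.single (Poly_Mapping.single i 1) 1"

definition qconst :: "rat \<Rightarrow> qmpoly" where
  "qconst c = Poly_Mapping.single 0 c"

definition mon_deg :: "(nat \<Rightarrow>\<^sub>0 nat) \<Rightarrow> nat" where
  "mon_deg m = (\<Sum>i\<in>Poly_Mapping.keys m. Poly_Mapping.lookup m i)"

definition total_degree :: "qmpoly \<Rightarrow> nat" where
  "total_degree p = Max (insert 0 (mon_deg ` Poly_Mapping.keys p))"

definition gen_f :: "nat \<Rightarrow> qmpoly poly" where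
  "gen_f n = monom 1 n + (\<Sum>i<n. monom (avar i) i)"

text \<open>Bivariate polynomials: elements of (Q[a])[x][y], with y the outer variable.\<close>

definition varX :: "qmpoly poly poly" where
  "varX = [: [:0, 1:] :]"

definition varY :: "qmpoly poly poly" where
  "varY = [:0, 1:]"

definition eval2 :: "qmpoly poly \<Rightarrow> qmpoly poly poly \<Rightarrow> qmpoly poly poly" where
  "eval2 p t = poly (map_poly (\<lambda>c. [:[:c:]:]) p) t"

definition f1 :: "nat \<Rightarrow> qmpoly poly poly" where
  "f1 n = (THE g. g * (varY - varX) = eval2 (gen_f n) varY - eval2 (gen_f n) varX)"

definition f3 :: "nat \<Rightarrow> qmpoly poly poly" where
  "f3 n = (THE g. g * (varY - varX)^2 =
      2 * (eval2 (gen_f n) varY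
           - 2 * eval2 (gen_f n) ((varX + varY) * [:[:qconst (1/2):]:])
           + eval2 (gen_f n) varX))"

definition E_res :: "nat \<Rightarrow> qmpoly" where
  "E_res n = resultant (gen_f n) (resultant (f1 n) (f3 n))"

end

theory Submission
  imports Defs "HOL-Computational_Algebra.Fundamental_Theorem_Algebra"
begin

text \<open>
  If \<open>f\<close> has roots \<open>r\<^sub>1, \<dots>, r\<^sub>n\<close>, then \<open>f\<^sub>1(r\<^sub>i, y)\<close> is the product of the \<open>y - r\<^sub>j\<close> with \<open>j \<noteq> i\<close>, and
  \<open>f\<^sub>3(r\<^sub>i, r\<^sub>j)\<close> is the product of the \<open>(r\<^sub>i + r\<^sub>j)/2 - r\<^sub>k\<close> with \<open>k \<noteq> i, j\<close>. Hence \<open>E\<close> is the product of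
  \<open>(r\<^sub>i + r\<^sub>j)/2 - r\<^sub>k\<close> over all triples of distinct indices. Its degree in a single root is the
  number \<open>3(n-1)(n-2)\<close> of triples containing a given index.

  The total degree \<open>D\<close> in the coefficients agrees with the degree in one root: for \<open>f = (x - t) g\<close> with
  \<open>g\<close> monic with coefficients \<open>b\<^sub>i\<close>, the coefficients of \<open>f\<close> are \<open>b\<^sub>i\<^sub>-\<^sub>1 - t b\<^sub>i\<close>, so the coefficient of
  \<open>t\<^sup>D\<close> in \<open>E\<close> is the degree-\<open>D\<close> part of \<open>E\<close> evaluated at \<open>-b\<close>. Since that part is homogeneous and nonzero,
  it does not vanish identically on the hyperplane where the last coordinate is \<open>-1\<close>.
\<close>

subsection \<open>The resultant with a product of linear factors\<close>

definition newton_poly :: "(nat \<Rightarrow> 'a::comm_ring_1) \<Rightarrow> nat \<Rightarrow> 'a poly" where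
  "newton_poly r n = (\<Prod>l<n. [:- r l, 1:])"

lemma newton_poly_0 [simp]: "newton_poly r 0 = 1"
  and newton_poly_Suc: "newton_poly r (Suc n) = newton_poly r n * [:- r n, 1:]"
  by (simp_all add: newton_poly_def)

lemma coeff_newton_poly_ge: "n \<le> m \<Longrightarrow> coeff (newton_poly r n) m = (if m = n then 1 else 0)"
proof (induction n arbitrary: m)
  case (Suc n)
  then obtain m' where "m = Suc m'" "n \<le> m'" by (cases m) auto
  with Suc.IH[of m'] Suc.IH[of m] show ?case
    by (simp add: newton_poly_Suc mult_pCons_right)
qed simp

lemma degree_newton_poly_le: "degree (newton_poly r n) \<le> n"
  by (rule degree_le) (simp add: coeff_newton_poly_ge)

text \<open>Synthetic division gives g = (x - r_i) q + g(r_i), hence N_i g = g(r_i) N_i + N_{i+1} q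
  with q of smaller degree, and the expansion continues at i + 1.\<close>

lemma newton_expansion:
  fixes g :: "'a::comm_ring_1 poly"
  assumes "i + degree g < N"
  shows "\<exists>c. c i = poly g (r i) \<and> newton_poly r i * g = (\<Sum>j=i..<N. smult (c j) (newton_poly r j))"
  using assms
proof (induction "N - i" arbitrary: i g)
  case (Suc d)
  define q where "q = synthetic_div g (r i)"
  have g: "g = [:- r i, 1:] * q + [:poly g (r i):]"
    by (simp only: q_def synthetic_div_correct')
  have split: "newton_poly r i * g = smult (poly g (r i)) (newton_poly r i) + newton_poly r (Suc i) * q"
    by (subst g) (simp add: newton_poly_Suc algebra_simps)
  show ?case
  proof (cases "degree g = 0")
    case True
    then have "q = 0" by (simp add: q_def synthetic_div_eq_0_iff)
    have "(\<Sum>j=i..<N. smult (if j = i then poly g (r i) else 0) (newton_poly r j))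
        = smult (poly g (r i)) (newton_poly r i)"
      using Suc.prems by (subst sum.mono_neutral_right[of _ "{i}"]) auto
    with split \<open>q = 0\<close> show ?thesis
      by (intro exI[of _ "\<lambda>j. if j = i then poly g (r i) else 0"]) simp
  next
    case False
    then have "degree q < degree g" by (simp add: q_def degree_synthetic_div)
    then obtain c where c: "newton_poly r (Suc i) * q = (\<Sum>j=Suc i..<N. smult (c j) (newton_poly r j))"
      using Suc.hyps(1)[of "Suc i" q] Suc.hyps(2) Suc.prems by fastforce
    have "newton_poly r i * g = (\<Sum>j=i..<N. smult ((c(i := poly g (r i))) j) (newton_poly r j))"
      using Suc.prems unfolding split c
      by (subst (2) sum.atLeast_Suc_lessThan) auto
    then show ?thesis by (intro exI[of _ "c(i := poly g (r i))"]) auto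
  qed
qed simp

text \<open>Reads each row as the coefficient vector of a shifted polynomial x^l p or x^l q, highest
  power first, so that row operations become polynomial identities.\<close>

lemma sylvester_mat_sub_row:
  fixes p q :: "'a::comm_ring_1 poly"
  assumes "degree p \<le> m" "degree q \<le> n" "i < m + n" "j < m + n"
  shows "sylvester_mat_sub m n p q $$ (i, j) =
    (if i < n then coeff (monom 1 (n - 1 - i) * p) (m + n - 1 - j)
     else coeff (monom 1 (m + n - 1 - i) * q) (m + n - 1 - j))"
proof -
  have *: "m + n - 1 - j - (n - 1 - i) = m + i - j" if "i < n" using that by linarith
  have **: "m + n - 1 - j - (m + n - 1 - i) = i - j" using assms by linarith
  show ?thesis
    using assms unfolding sylvester_mat_sub_index[OF assms(3,4)] coeff_monom_mult
    by (auto simp: * ** intro!: coeff_eq_0)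
qed

text \<open>In the Newton basis \<open>N\<^sub>j = (x - r\<^sub>0)\<cdots>(x - r\<^sub>j\<^sub>-\<^sub>1)\<close>, continued by \<open>N\<^sub>n\<^sub>+\<^sub>l = x\<^sup>l f\<close>, the polynomials
  \<open>N\<^sub>i g\<close> only involve \<open>N\<^sub>j\<close> with \<open>j \<ge> i\<close>, and the coefficient of \<open>N\<^sub>i\<close> is \<open>g(r\<^sub>i)\<close>. So two unitriangular
  changes of basis (\<open>L\<close> and \<open>C\<close>) turn the Sylvester matrix into a triangular one (\<open>M\<close>).\<close>

lemma resultant_sub_prod_linear:
  fixes g :: "'a::comm_ring_1 poly"
  assumes deg: "degree g \<le> k"
  shows "resultant_sub n k (\<Prod>i<n. [:- r i, 1:]) g = (\<Prod>i<n. poly g (r i))"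
proof -
  \<comment> \<open>Padding the nodes with zeros makes every Newton polynomial beyond index n equal
    to a power of x times f.\<close>
  define s where "s i = (if i < n then r i else 0)" for i
  define f where "f = newton_poly s n"
  have f: "(\<Prod>i<n. [:- r i, 1:]) = f"
    unfolding f_def newton_poly_def by (intro prod.cong) (auto simp: s_def)
  have tail: "newton_poly s (n + l) = monom 1 l * f" for l
  proof (induction l)
    case (Suc l)
    have "s (n + l) = 0" by (simp add: s_def)
    with Suc show ?case by (simp add: newton_poly_Suc monom_Suc)
  qed (simp add: f_def)
  define N where "N = n + k"
  \<comment> \<open>Row a belongs to the Newton index N - 1 - a. The first k rows have index at
    least n and already contain f; the other n rows are multiplied by g.\<close>
  define P where "P a = newton_poly s (N - 1 - a) * (if a < k then 1 else g)" for a
  define S where "S = sylvester_mat_sub n k f g"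
  \<comment> \<open>\<open>L\<close> leaves the k rows of f alone and replaces the rows x^j g by N_j
    g for j < n.\<close>
  define L where "L = mat N N (\<lambda>(a, b). if a < k then if b = a then 1 else 0
    else if b < k then 0 else coeff (newton_poly s (N - 1 - a)) (N - 1 - b))"
  define C where "C = mat N N (\<lambda>(a, b). coeff (newton_poly s (N - 1 - a)) (N - 1 - b))"
  have "\<exists>c. c (N - 1 - a) = (if a < k then 1 else poly g (s (N - 1 - a))) \<and>
      P a = (\<Sum>j=N - 1 - a..<N. smult (c j) (newton_poly s j))" if "a < N" for a
    using newton_expansion[of "N - 1 - a" "if a < k then 1 else g" N s] deg that
    by (auto simp: P_def N_def)
  then obtain c where c: "\<And>a. a < N \<Longrightarrow> c a (N - 1 - a) = (if a < k then 1 else poly g (s (N - 1 - a)))"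
    "\<And>a. a < N \<Longrightarrow> P a = (\<Sum>j=N - 1 - a..<N. smult (c a j) (newton_poly s j))"
    by metis
  define M where "M = mat N N (\<lambda>(a, b). if b \<le> a then c a (N - 1 - b) else 0)"
  have carr: "S \<in> carrier_mat N N" "L \<in> carrier_mat N N" "C \<in> carrier_mat N N" "M \<in> carrier_mat N N"
    unfolding S_def L_def C_def M_def N_def by auto
  have degf: "degree f \<le> n" by (simp add: f_def degree_newton_poly_le)
  \<comment> \<open>Row a of either product is the coefficient vector of \<open>P a\<close>: on the
    left assembled from the rows of the Sylvester matrix, on the right from its Newton
    expansion.\<close>
  have "L * S = M * C"
  proof (rule eq_matI)
    fix a b assume "a < dim_row (M * C)" "b < dim_col (M * C)"
    then have ab: "a < N" "b < N" using carr by auto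
    have "(L * S) $$ (a, b) = (\<Sum>l<N. L $$ (a, l) * S $$ (l, b))"
      using ab carr by (simp add: scalar_prod_def atLeast0LessThan)
    also have "\<dots> = coeff (P a) (N - 1 - b)"
    proof (cases "a < k")
      case True
      have "(\<Sum>l<N. L $$ (a, l) * S $$ (l, b)) = (\<Sum>l<N. if l = a then S $$ (a, b) else 0)"
        using ab True by (intro sum.cong) (auto simp: L_def)
      also have "\<dots> = S $$ (a, b)" using ab by simp
      also have "\<dots> = coeff (monom 1 (k - 1 - a) * f) (N - 1 - b)"
        using True ab by (simp add: S_def sylvester_mat_sub_row degf deg N_def)
      also have "monom 1 (k - 1 - a) * f = P a"
        using True tail[of "k - 1 - a"] by (simp add: P_def N_def)
      finally show ?thesis .
    next
      case False
      let ?p = "newton_poly s (N - 1 - a)"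
      have "(\<Sum>l<N. L $$ (a, l) * S $$ (l, b)) =
          (\<Sum>l<N. coeff ?p (N - Suc l) * coeff (monom 1 (N - Suc l) * g) (N - 1 - b))"
        using False ab carr deg degf
        by (intro sum.cong) (auto simp: L_def S_def N_def sylvester_mat_sub_row coeff_newton_poly_ge)
      also have "\<dots> = (\<Sum>l<N. coeff ?p l * coeff (monom 1 l * g) (N - 1 - b))"
        by (rule sum.nat_diff_reindex)
      also have "\<dots> = coeff ((\<Sum>l<N. monom (coeff ?p l) l) * g) (N - 1 - b)"
        by (auto simp: sum_distrib_right coeff_sum coeff_monom_mult intro!: sum.cong)
      also have "(\<Sum>l<N. monom (coeff ?p l) l) = ?p"
        using ab by (auto simp: poly_eq_iff coeff_sum coeff_newton_poly_ge)
      finally show ?thesis using False by (simp add: P_def)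
    qed
    also have "\<dots> = (\<Sum>l=N-1-a..<N. c a l * coeff (newton_poly s l) (N - 1 - b))"
      using c(2)[OF ab(1)] by (simp add: coeff_sum)
    also have "\<dots> = (\<Sum>l<N. if N - 1 - a \<le> l then c a l * coeff (newton_poly s l) (N - 1 - b) else 0)"
      by (intro sum.mono_neutral_cong_left) auto
    also have "\<dots> = (\<Sum>l<N. if N - 1 - a \<le> N - Suc l then c a (N - Suc l) * coeff (newton_poly s (N - Suc l)) (N - 1 - b) else 0)"
      by (rule sum.nat_diff_reindex[symmetric])
    also have "\<dots> = (\<Sum>l<N. M $$ (a, l) * C $$ (l, b))"
      using ab by (intro sum.cong) (auto simp: M_def C_def)
    also have "\<dots> = (M * C) $$ (a, b)"
      using ab carr by (simp add: scalar_prod_def atLeast0LessThan)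
    finally show "(L * S) $$ (a, b) = (M * C) $$ (a, b)" .
  qed (use carr in auto)
  then have "det L * det S = det M * det C"
    using carr by (metis det_mult)
  moreover have "det L = 1"
    using carr
    by (subst det_upper_triangular[of _ N])
      (auto simp: L_def prod_list_diag_prod coeff_newton_poly_ge intro!: prod.neutral upper_triangularI)
  moreover have "det C = 1"
    using carr
    by (subst det_upper_triangular[of _ N])
      (auto simp: C_def prod_list_diag_prod coeff_newton_poly_ge intro!: prod.neutral upper_triangularI)
  moreover have "det M = (\<Prod>a<N. if a < k then 1 else poly g (s (N - 1 - a)))"
    using carr c(1)
    by (subst det_lower_triangular[of N])
      (auto simp: M_def prod_list_diag_prod atLeast0LessThan intro!: prod.cong)
  moreover have "\<dots> = (\<Prod>a<N. if N - Suc a < k then 1 else poly g (s (N - 1 - (N - Suc a))))"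
    by (rule prod.nat_diff_reindex[symmetric])
  moreover have "\<dots> = (\<Prod>a<n. poly g (r a))"
    by (intro prod.mono_neutral_cong_right) (auto simp: N_def s_def)
  ultimately show ?thesis
    by (simp add: f resultant_sub_def S_def)
qed

lemma resultant_sub_prod_linear_set:
  fixes g :: "'a::comm_ring_1 poly"
  assumes "finite I" "degree g \<le> k"
  shows "resultant_sub (card I) k (\<Prod>i\<in>I. [:- r i, 1:]) g = (\<Prod>i\<in>I. poly g (r i))"
proof -
  obtain h where h: "bij_betw h {..<card I} I"
    using ex_bij_betw_nat_finite[OF assms(1)] by (auto simp: atLeast0LessThan)
  show ?thesis
    using resultant_sub_prod_linear[OF assms(2), of "card I" "\<lambda>l. r (h l)"]
    by (simp only: prod.reindex_bij_betw[OF h, of "\<lambda>i. [:- r i, 1:]"]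
        prod.reindex_bij_betw[OF h, of "\<lambda>i. poly g (r i)"])
qed

subsection \<open>Evaluation of multivariate polynomials\<close>

definition mon_eval :: "(nat \<Rightarrow> 'a::comm_ring_1) \<Rightarrow> (nat \<Rightarrow>\<^sub>0 nat) \<Rightarrow> 'a" where
  "mon_eval c m = (\<Prod>i\<in>Poly_Mapping.keys m. c i ^ Poly_Mapping.lookup m i)"

lemma mon_eval_superset:
  assumes "finite I" "Poly_Mapping.keys m \<subseteq> I"
  shows "mon_eval c m = (\<Prod>i\<in>I. c i ^ Poly_Mapping.lookup m i)"
  unfolding mon_eval_def using assms
  by (intro prod.mono_neutral_left) (auto simp: in_keys_iff)

lemma mon_eval_0 [simp]: "mon_eval c 0 = 1"
  by (simp add: mon_eval_def)

lemma mon_eval_add: "mon_eval c (m + m') = mon_eval c m * mon_eval c m'"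
proof -
  let ?I = "Poly_Mapping.keys m \<union> Poly_Mapping.keys m'"
  have "Poly_Mapping.keys (m + m') \<subseteq> ?I" by (rule Poly_Mapping.keys_add)
  then show ?thesis
    by (simp add: mon_eval_superset[of ?I] lookup_add power_add prod.distrib)
qed

text \<open>The coefficient map is a parameter because the target is the ring itself (via
  \<open>qconst\<close>) in one use and complex polynomials in t in the other.\<close>

definition mp_eval :: "(rat \<Rightarrow> 'a) \<Rightarrow> (nat \<Rightarrow> 'a::comm_ring_1) \<Rightarrow> qmpoly \<Rightarrow> 'a" where
  "mp_eval \<kappa> c p = (\<Sum>m\<in>Poly_Mapping.keys p. \<kappa> (Poly_Mapping.lookup p m) * mon_eval c m)"

lemma sum_single_lookup:
  fixes p :: "'a \<Rightarrow>\<^sub>0 'b::comm_monoid_add"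
  shows "(\<Sum>m\<in>Poly_Mapping.keys p. Poly_Mapping.single m (Poly_Mapping.lookup p m)) = p"
  by (rule poly_mapping_eqI) (auto simp: lookup_sum lookup_single when_def in_keys_iff)

context
  fixes \<kappa> :: "rat \<Rightarrow> 'a::comm_ring_1"
  assumes \<kappa>: "comm_ring_hom \<kappa>"
begin

interpretation \<kappa>: comm_ring_hom \<kappa> by (fact \<kappa>)

lemma mp_eval_superset:
  assumes "finite K" "Poly_Mapping.keys p \<subseteq> K"
  shows "mp_eval \<kappa> c p = (\<Sum>m\<in>K. \<kappa> (Poly_Mapping.lookup p m) * mon_eval c m)"
  unfolding mp_eval_def using assms
  by (intro sum.mono_neutral_left) (auto simp: in_keys_iff)

lemma mp_eval_single: "mp_eval \<kappa> c (Poly_Mapping.single m a) = \<kappa> a * mon_eval c m"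
  by (simp add: mp_eval_superset[of "{m}"])

lemma mp_eval_add: "mp_eval \<kappa> c (p + q) = mp_eval \<kappa> c p + mp_eval \<kappa> c q"
proof -
  let ?K = "Poly_Mapping.keys p \<union> Poly_Mapping.keys q"
  have "Poly_Mapping.keys (p + q) \<subseteq> ?K" by (rule Poly_Mapping.keys_add)
  then show ?thesis
    by (simp add: mp_eval_superset[of ?K] lookup_add \<kappa>.hom_add distrib_right sum.distrib)
qed

lemma mp_eval_sum: "mp_eval \<kappa> c (\<Sum>x\<in>K. F x) = (\<Sum>x\<in>K. mp_eval \<kappa> c (F x))"
proof (induction K rule: infinite_finite_induct)
qed (simp_all add: mp_eval_add, simp_all add: mp_eval_def)

lemma mp_eval_mult: "mp_eval \<kappa> c (p * q) = mp_eval \<kappa> c p * mp_eval \<kappa> c q"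
proof -
  let ?s = "\<lambda>p m. Poly_Mapping.single m (Poly_Mapping.lookup p m) :: qmpoly"
  have "p * q = (\<Sum>m\<in>Poly_Mapping.keys p. ?s p m) * (\<Sum>m\<in>Poly_Mapping.keys q. ?s q m)"
    by (simp only: sum_single_lookup)
  also have "\<dots> = (\<Sum>m\<in>Poly_Mapping.keys p. \<Sum>m'\<in>Poly_Mapping.keys q. ?s p m * ?s q m')"
    by (rule sum_product)
  finally show ?thesis
    by (simp add: mult_single mp_eval_sum mp_eval_single \<kappa>.hom_mult mon_eval_add mp_eval_def[of _ _ p]
        mp_eval_def[of _ _ q] sum_product mult_ac)
qed

lemma comm_ring_hom_mp_eval: "comm_ring_hom (mp_eval \<kappa> c)"
proof
  show "mp_eval \<kappa> c 1 = 1"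
    by (simp add: mp_eval_single flip: single_one)
qed (simp_all add: mp_eval_add mp_eval_mult, simp add: mp_eval_def)

lemma mp_eval_avar [simp]: "mp_eval \<kappa> c (avar i) = c i"
  by (simp add: avar_def mp_eval_single mon_eval_superset[of "{i}"])

lemma mp_eval_qconst [simp]: "mp_eval \<kappa> c (qconst a) = \<kappa> a"
  by (simp add: qconst_def mp_eval_single)

end

section \<open>Polynomials involving only the first n indeterminates\<close>

lemma qconst_hom: "comm_ring_hom qconst"
  by standard (simp_all add: qconst_def single_add mult_single)

lemma avar_power: "avar i ^ k = Poly_Mapping.single (Poly_Mapping.single i k) 1"
  by (induction k) (simp_all add: avar_def mult_single flip: single_add)

lemma mon_eval_avar: "mon_eval avar m = Poly_Mapping.single m 1"
proof -
  have "(\<Prod>i\<in>I. Poly_Mapping.single (h i) 1) = (Poly_Mapping.single (\<Sum>i\<in>I. h i) 1 :: qmpoly)"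
    for h :: "nat \<Rightarrow> nat \<Rightarrow>\<^sub>0 nat" and I
    by (induction I rule: infinite_finite_induct) (simp_all add: mult_single)
  then show ?thesis
    by (simp add: mon_eval_def avar_power sum_single_lookup)
qed

lemma mon_eval_truncated:
  assumes "\<not> Poly_Mapping.keys m \<subseteq> {..<n}"
  shows "mon_eval (\<lambda>i. if i < n then c i else 0) m = 0"
proof -
  from assms obtain i where "i \<in> Poly_Mapping.keys m" "\<not> i < n" by auto
  then show ?thesis unfolding mon_eval_def
    by (intro prod_zero bexI[of _ i]) (auto simp: in_keys_iff zero_power)
qed

lemma mon_eval_cong:
  assumes "\<And>i. i \<in> Poly_Mapping.keys m \<Longrightarrow> c i = c' i"
  shows "mon_eval c m = mon_eval c' m"
  using assms by (simp add: mon_eval_def)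

text \<open>Setting the indeterminates from n on to zero kills every monomial that contains one of
  them and keeps the others, so such a monomial cannot survive in a fixed polynomial.\<close>

lemma keys_subset_if_mp_eval_fixed:
  assumes fixed: "mp_eval qconst (\<lambda>i. if i < n then avar i else 0) p = p"
    and m: "m \<in> Poly_Mapping.keys p"
  shows "Poly_Mapping.keys m \<subseteq> {..<n}"
proof (rule ccontr)
  assume not: "\<not> Poly_Mapping.keys m \<subseteq> {..<n}"
  let ?c = "\<lambda>i. if i < n then avar i else 0"
  have "Poly_Mapping.lookup (qconst a * mon_eval ?c m') m = 0" for a m'
  proof (cases "Poly_Mapping.keys m' \<subseteq> {..<n}")
    case True
    then have "mon_eval ?c m' = Poly_Mapping.single m' 1"
      by (subst mon_eval_cong[of _ _ avar]) (auto simp: mon_eval_avar)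
    moreover have "m' \<noteq> m" using True not by auto
    ultimately show ?thesis by (simp add: qconst_def mult_single lookup_single)
  next
    case False
    then show ?thesis by (simp add: mon_eval_truncated)
  qed
  then have "Poly_Mapping.lookup (mp_eval qconst ?c p) m = 0"
    by (simp add: mp_eval_def lookup_sum)
  with fixed m show False by (simp add: in_keys_iff)
qed

section \<open>Total degree under substitutions that are linear in one variable\<close>

lemma mon_deg_superset:
  assumes "finite I" "Poly_Mapping.keys m \<subseteq> I"
  shows "mon_deg m = (\<Sum>i\<in>I. Poly_Mapping.lookup m i)"
  unfolding mon_deg_def using assms
  by (intro sum.mono_neutral_left) (auto simp: in_keys_iff)

lemma mon_deg_le_total_degree: "m \<in> Poly_Mapping.keys p \<Longrightarrow> mon_deg m \<le> total_degree p"
  unfolding total_degree_def by (intro Max_ge) auto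

lemma total_degree_attained:
  assumes "total_degree p > 0"
  obtains m where "m \<in> Poly_Mapping.keys p" "mon_deg m = total_degree p"
proof -
  have "total_degree p \<in> insert 0 (mon_deg ` Poly_Mapping.keys p)"
    unfolding total_degree_def by (intro Max_in) auto
  with assms that show thesis by auto
qed

text \<open>Every other pair of indices with sum a + b exceeds one of the bounds. Bounds instead of
  exact degrees allow the coefficients at a and b to vanish.\<close>

lemma coeff_mult_bounds:
  fixes p q :: "'a::comm_semiring_1 poly"
  assumes "degree p \<le> a" "degree q \<le> b"
  shows "coeff (p * q) (a + b) = coeff p a * coeff q b"
proof -
  have "coeff (p * q) (a + b) = (\<Sum>i\<le>a + b. coeff p i * coeff q (a + b - i))"
    by (rule coeff_mult)
  also have "\<dots> = (\<Sum>i\<in>{a}. coeff p i * coeff q (a + b - i))"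
  proof (intro sum.mono_neutral_right ballI)
    fix i assume "i \<in> {..a + b} - {a}"
    then have "i > a \<or> a + b - i > b" by auto
    then show "coeff p i * coeff q (a + b - i) = 0"
      using assms by (auto simp: coeff_eq_0)
  qed auto
  finally show ?thesis by simp
qed

lemma coeff_power_bound:
  fixes p :: "'a::comm_semiring_1 poly"
  assumes "degree p \<le> 1"
  shows "degree (p ^ k) \<le> k \<and> coeff (p ^ k) k = coeff p 1 ^ k"
proof (induction k)
  case (Suc k)
  have "degree (p * p ^ k) \<le> 1 + k"
    by (rule order.trans[OF degree_mult_le]) (use assms Suc in auto)
  with coeff_mult_bounds[of p 1 "p ^ k" k] assms Suc show ?case by simp
qed simp

lemma mon_eval_linear:
  fixes c :: "nat \<Rightarrow> 'a::comm_ring_1 poly"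
  assumes "\<And>i. degree (c i) \<le> 1"
  shows "degree (mon_eval c m) \<le> mon_deg m"
    and "coeff (mon_eval c m) (mon_deg m) = mon_eval (\<lambda>i. coeff (c i) 1) m"
proof -
  let ?e = "Poly_Mapping.lookup m"
  have "finite I \<Longrightarrow> degree (\<Prod>i\<in>I. c i ^ ?e i) \<le> (\<Sum>i\<in>I. ?e i) \<and>
      coeff (\<Prod>i\<in>I. c i ^ ?e i) (\<Sum>i\<in>I. ?e i) = (\<Prod>i\<in>I. coeff (c i) 1 ^ ?e i)" for I
  proof (induction I rule: finite_induct)
    case (insert i I)
    then show ?case
      using coeff_power_bound[OF assms[of i], of "?e i"]
        coeff_mult_bounds[of "c i ^ ?e i" "?e i" "\<Prod>i\<in>I. c i ^ ?e i" "\<Sum>i\<in>I. ?e i"]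
        degree_mult_le[of "c i ^ ?e i" "\<Prod>i\<in>I. c i ^ ?e i"]
      by simp
  qed simp
  from this[of "Poly_Mapping.keys m"]
  show "degree (mon_eval c m) \<le> mon_deg m"
    and "coeff (mon_eval c m) (mon_deg m) = mon_eval (\<lambda>i. coeff (c i) 1) m"
    by (simp_all add: mon_eval_def mon_deg_def)
qed

text \<open>A monomial of degree d becomes a polynomial of degree at most d. Only the top
  homogeneous part can therefore reach the power D, and there it is evaluated at the linear
  coefficients of the substituted polynomials.\<close>

lemma mp_eval_linear:
  fixes c :: "nat \<Rightarrow> 'a::field_char_0 poly" and p :: qmpoly
  assumes c: "\<And>i. degree (c i) \<le> 1"
  defines "P \<equiv> mp_eval (\<lambda>x. [:of_rat x:]) c p"
  shows "degree P \<le> total_degree p"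
    and "coeff P (total_degree p) = (\<Sum>m | m \<in> Poly_Mapping.keys p \<and> mon_deg m = total_degree p.
      of_rat (Poly_Mapping.lookup p m) * mon_eval (\<lambda>i. coeff (c i) 1) m)"
proof -
  let ?D = "total_degree p"
  show "degree P \<le> ?D"
    unfolding P_def mp_eval_def
  proof (rule degree_sum_le)
    fix m assume "m \<in> Poly_Mapping.keys p"
    then show "degree ([:of_rat (Poly_Mapping.lookup p m):] * mon_eval c m) \<le> ?D"
      using degree_smult_le[of "of_rat (Poly_Mapping.lookup p m)" "mon_eval c m"]
        mon_eval_linear(1)[of c m, OF c] mon_deg_le_total_degree[of m p] by simp
  qed simp
  have "coeff P ?D = (\<Sum>m\<in>Poly_Mapping.keys p.
      of_rat (Poly_Mapping.lookup p m) * coeff (mon_eval c m) ?D)"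
    by (simp add: P_def mp_eval_def coeff_sum)
  also have "\<dots> = (\<Sum>m | m \<in> Poly_Mapping.keys p \<and> mon_deg m = ?D.
      of_rat (Poly_Mapping.lookup p m) * mon_eval (\<lambda>i. coeff (c i) 1) m)"
  proof (rule sum.mono_neutral_cong_right)
    show "\<forall>m\<in>Poly_Mapping.keys p - {m. m \<in> Poly_Mapping.keys p \<and> mon_deg m = ?D}.
      of_rat (Poly_Mapping.lookup p m) * coeff (mon_eval c m) ?D = 0"
    proof
      fix m assume m: "m \<in> Poly_Mapping.keys p - {m. m \<in> Poly_Mapping.keys p \<and> mon_deg m = ?D}"
      then have "mon_deg m < ?D" using mon_deg_le_total_degree[of m p] by auto
      then have "coeff (mon_eval c m) ?D = 0"
        using mon_eval_linear(1)[of c m, OF c] by (intro coeff_eq_0) auto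
      then show "of_rat (Poly_Mapping.lookup p m) * coeff (mon_eval c m) ?D = 0" by simp
    qed
  next
    fix m assume "m \<in> {m. m \<in> Poly_Mapping.keys p \<and> mon_deg m = ?D}"
    then show "of_rat (Poly_Mapping.lookup p m) * coeff (mon_eval c m) ?D =
      of_rat (Poly_Mapping.lookup p m) * mon_eval (\<lambda>i. coeff (c i) 1) m"
      using mon_eval_linear(2)[of c m, OF c] by auto
  qed auto
  finally show "coeff P ?D = (\<Sum>m | m \<in> Poly_Mapping.keys p \<and> mon_deg m = ?D.
      of_rat (Poly_Mapping.lookup p m) * mon_eval (\<lambda>i. coeff (c i) 1) m)" .
qed

section \<open>Nonvanishing of a homogeneous polynomial on an affine hyperplane\<close>

lemma base_expansion_unique:
  fixes M :: nat
  assumes "\<And>i. i < k \<Longrightarrow> x i < M" "\<And>i. i < k \<Longrightarrow> y i < M"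
    and "(\<Sum>i<k. x i * M ^ i) = (\<Sum>i<k. y i * M ^ i)" "i < k"
  shows "x i = y i"
  using assms
proof (induction k arbitrary: x y i)
  case (Suc k)
  have shift: "(\<Sum>i<Suc k. z i * M ^ i) = z 0 + M * (\<Sum>i<k. z (Suc i) * M ^ i)" for z
    by (subst sum.lessThan_Suc_shift) (simp add: sum_distrib_left algebra_simps)
  have eq: "x 0 + M * (\<Sum>i<k. x (Suc i) * M ^ i) = y 0 + M * (\<Sum>i<k. y (Suc i) * M ^ i)"
    using Suc.prems(3) by (simp only: shift)
  have lt: "x 0 < M" "y 0 < M" using Suc.prems(1,2) by auto
  have "(x 0 + M * (\<Sum>i<k. x (Suc i) * M ^ i)) mod M = x 0" using lt by simp
  moreover have "(y 0 + M * (\<Sum>i<k. y (Suc i) * M ^ i)) mod M = y 0" using lt by simp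
  ultimately have 0: "x 0 = y 0" using eq by simp
  then have "(\<Sum>i<k. x (Suc i) * M ^ i) = (\<Sum>i<k. y (Suc i) * M ^ i)" using eq lt by simp
  then have "x (Suc i) = y (Suc i)" if "i < k" for i
    using Suc.IH[of "\<lambda>i. x (Suc i)" "\<lambda>i. y (Suc i)" i] Suc.prems(1,2) that by auto
  with 0 Suc.prems(4) show ?case by (cases i) auto
qed simp

text \<open>Kronecker substitution: the exponents below \<open>n\<close> are read as digits in base \<open>D + 1\<close>, and homogeneity
  recovers the exponent of the variable \<open>n\<close>.\<close>

lemma homogeneous_nonvanishing_point:
  fixes \<alpha> :: "(nat \<Rightarrow>\<^sub>0 nat) \<Rightarrow> 'a::{idom,ring_char_0}"
  assumes "finite K" "K \<noteq> {}" "e \<noteq> 0"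
    and K: "\<And>m. m \<in> K \<Longrightarrow> Poly_Mapping.keys m \<subseteq> {..<Suc n} \<and> mon_deg m = D \<and> \<alpha> m \<noteq> 0"
  obtains b where "b n = e" "(\<Sum>m\<in>K. \<alpha> m * mon_eval b m) \<noteq> 0"
proof -
  define w where "w m = (\<Sum>i<n. Poly_Mapping.lookup m i * Suc D ^ i)" for m
  have deg: "(\<Sum>i<n. Poly_Mapping.lookup m i) + Poly_Mapping.lookup m n = D" if "m \<in> K" for m
    using K[OF that] mon_deg_superset[of "{..<Suc n}" m] by simp
  have inj: "inj_on w K"
  proof
    fix m m' assume m: "m \<in> K" "m' \<in> K" and eq: "w m = w m'"
    \<comment> \<open>Homogeneity bounds every exponent by D, so the exponents are admissible
      digits.\<close>
    have bd: "Poly_Mapping.lookup q i < Suc D" if "q \<in> K" "i < n" for q i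
      using member_le_sum[of i "{..<n}" "Poly_Mapping.lookup q"] deg[OF that(1)] that(2) by simp
    have low: "Poly_Mapping.lookup m i = Poly_Mapping.lookup m' i" if "i < n" for i
      using base_expansion_unique[of n "Poly_Mapping.lookup m" "Suc D" "Poly_Mapping.lookup m'" i]
        bd m eq that by (auto simp: w_def)
    moreover from this have "Poly_Mapping.lookup m n = Poly_Mapping.lookup m' n"
      using deg[OF m(1)] deg[OF m(2)] by simp
    moreover have "Poly_Mapping.lookup q i = 0" if "q \<in> K" "i > n" for q i
      using K[OF that(1)] that(2) by (metis in_keys_iff lessThan_iff not_less_eq subsetD)
    ultimately have "Poly_Mapping.lookup m i = Poly_Mapping.lookup m' i" for i
      using m by (metis linorder_neqE_nat)
    then show "m = m'" by (rule poly_mapping_eqI)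
  qed
  define Q where "Q = (\<Sum>m\<in>K. monom (\<alpha> m * e ^ Poly_Mapping.lookup m n) (w m))"
  obtain m0 where m0: "m0 \<in> K" using assms(2) by auto
  have "coeff Q (w m0) = (\<Sum>m\<in>K. if m = m0 then \<alpha> m * e ^ Poly_Mapping.lookup m n else 0)"
    unfolding Q_def coeff_sum using inj m0 by (intro sum.cong) (auto dest: inj_onD)
  also have "\<dots> = \<alpha> m0 * e ^ Poly_Mapping.lookup m0 n" using m0 assms(1) by simp
  finally have "Q \<noteq> 0" using K[OF m0] assms(3) by auto
  \<comment> \<open>A nonzero polynomial over an infinite domain has a non-root u. Assigning to the
    variable i the value u^((D+1)^i) turns the sum into Q(u).\<close>
  then obtain u where u: "poly Q u \<noteq> 0" using poly_all_0_iff_0 by blast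
  define b where "b i = (if i < n then u ^ (Suc D ^ i) else e)" for i
  have "mon_eval b m = u ^ w m * e ^ Poly_Mapping.lookup m n" if "m \<in> K" for m
  proof -
    have "mon_eval b m = (\<Prod>i<n. (u ^ (Suc D ^ i)) ^ Poly_Mapping.lookup m i) * e ^ Poly_Mapping.lookup m n"
      using K[OF that] by (subst mon_eval_superset[of "{..<Suc n}"]) (auto simp: b_def)
    also have "(\<Prod>i<n. (u ^ (Suc D ^ i)) ^ Poly_Mapping.lookup m i) = u ^ w m"
      by (simp add: w_def power_sum mult.commute flip: power_mult)
    finally show ?thesis .
  qed
  then have "(\<Sum>m\<in>K. \<alpha> m * mon_eval b m) = poly Q u"
    by (simp add: Q_def poly_sum poly_monom algebra_simps)
  with u that[of b] show thesis by (simp add: b_def)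
qed

subsection \<open>The polynomials $f_1$ and $f_3$ under specialisation\<close>

lemma coeff_gen_f: "coeff (gen_f n) i = (if i < n then avar i else if i = n then 1 else 0)"
  by (auto simp: gen_f_def coeff_sum)

lemma degree_gen_f: "degree (gen_f n) = n"
  by (rule antisym[OF degree_le le_degree]) (auto simp: coeff_gen_f)

lemma map_poly_eval2:
  fixes \<Psi> :: "qmpoly poly \<Rightarrow> 'b::comm_ring_1"
  assumes "comm_ring_hom \<Psi>"
  shows "map_poly \<Psi> (eval2 p t) = pcompose (map_poly (\<lambda>c. \<Psi> [:c:]) p) (map_poly \<Psi> t)"
proof -
  interpret comm_ring_hom \<Psi> by fact
  interpret P: map_poly_comm_ring_hom \<Psi> ..
  show ?thesis unfolding eval2_def
    by (induction p) (simp_all add: pcompose_pCons map_poly_pCons hom_distribs map_poly_pCons P.hom_mult P.hom_add)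
qed

lemma eval2_conv_pcompose: "eval2 p t = pcompose (map_poly (\<lambda>c. [:c:]) p) t"
  unfolding eval2_def by (induction p) (simp_all add: pcompose_pCons map_poly_pCons)

lemma varY_minus_varX: "varY - varX = [:-[:0, 1:], 1:]"
  by (simp add: varX_def varY_def)

lemma varY_minus_varX_nz: "varY - varX \<noteq> 0"
  by (simp add: varY_minus_varX)

text \<open>Replaces the definite description by its equation: y = x is a root of the right side,
  which gives a quotient, and cancellation makes it unique.\<close>

lemma f1_mult: "f1 n * (varY - varX) = eval2 (gen_f n) varY - eval2 (gen_f n) varX"
proof -
  let ?Q = "eval2 (gen_f n) varY - eval2 (gen_f n) varX"
  have "poly ?Q [:0, 1:] = 0"
    by (simp add: eval2_conv_pcompose poly_pcompose varX_def varY_def)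
  then have "(varY - varX) dvd ?Q"
    unfolding varY_minus_varX by (simp only: poly_eq_0_iff_dvd)
  then obtain g where g: "g * (varY - varX) = ?Q" by (metis dvdE mult.commute)
  show ?thesis unfolding f1_def
    by (rule theI[of _ g]) (simp_all only: g mult_right_cancel[OF varY_minus_varX_nz] flip: g)
qed

text \<open>Horner induction: passing from p to a + x p multiplies the first-order Taylor remainder
  by h + d and adds d^2 p'(h).\<close>

lemma power2_dvd_taylor:
  fixes p :: "'a::idom poly"
  shows "d\<^sup>2 dvd poly p (h + d) - poly p h - d * poly (pderiv p) h"
proof (induction p)
  case (pCons a p)
  have "poly (pCons a p) (h + d) - poly (pCons a p) h - d * poly (pderiv (pCons a p)) h
    = (h + d) * (poly p (h + d) - poly p h - d * poly (pderiv p) h) + d\<^sup>2 * poly (pderiv p) h"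
    by (simp add: pderiv_pCons algebra_simps power2_eq_square)
  then show ?case using pCons.IH by simp
qed simp

text \<open>The first-order terms of the Taylor expansions with steps d and -d cancel.\<close>

lemma power2_dvd_second_difference:
  fixes p :: "'a::idom poly"
  shows "d\<^sup>2 dvd poly p (h + d) - 2 * poly p h + poly p (h - d)"
proof -
  have "poly p (h + d) - 2 * poly p h + poly p (h - d)
    = (poly p (h + d) - poly p h - d * poly (pderiv p) h)
    + (poly p (h + (- d)) - poly p h - (- d) * poly (pderiv p) h)"
    by (simp add: algebra_simps)
  then show ?thesis
    using power2_dvd_taylor[of d p h] power2_dvd_taylor[of "- d" p h] by (metis dvd_add power2_minus)
qed

lemma qconst_half: "qconst (1/2) + qconst (1/2) = 1"
  by (simp add: qconst_def flip: single_add)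

lemma f3_mult: "f3 n * (varY - varX)^2 =
      2 * (eval2 (gen_f n) varY
           - 2 * eval2 (gen_f n) ((varX + varY) * [:[:qconst (1/2):]:])
           + eval2 (gen_f n) varX)" (is "_ = ?Q")
proof -
  define c :: "qmpoly poly poly" where "c = [:[:qconst (1/2):]:]"
  have c: "c + c = 1" by (simp add: c_def qconst_half flip: one_pCons)
  have t: "t * c + t * c = t" for t by (metis c distrib_left mult.right_neutral)
  \<comment> \<open>With h = (x + y)/2 and d = (y - x)/2, the points h + d and h - d are y and x, so
    the right side is twice a second difference.\<close>
  define h where "h = (varX + varY) * c"
  define d where "d = (varY - varX) * c"
  have "h + d = varY" "h - d = varX"
    using t[of varY] t[of varX] by (simp_all add: h_def d_def algebra_simps)
  then have "d\<^sup>2 dvd eval2 (gen_f n) varY - 2 * eval2 (gen_f n) h + eval2 (gen_f n) varX"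
    using power2_dvd_second_difference[of d "map_poly (\<lambda>c. [:[:c:]:]) (gen_f n)" h]
    by (simp add: eval2_def)
  moreover have "(varY - varX)\<^sup>2 dvd d\<^sup>2" by (simp add: d_def power_mult_distrib)
  ultimately have "(varY - varX)\<^sup>2 dvd ?Q" unfolding h_def c_def by (meson dvd_mult dvd_trans)
  then obtain g where g: "g * (varY - varX)^2 = ?Q" by (metis dvdE mult.commute)
  show ?thesis unfolding f3_def
    by (rule theI[of _ g]) (simp_all only: g mult_right_cancel[OF power_not_zero[OF varY_minus_varX_nz]] flip: g)
qed

section \<open>Evaluation of E when f splits into linear factors\<close>

lemma pcompose_constant: "pcompose p [:a:] = [:poly p a:]"
  by (induction p) (simp_all add: pcompose_pCons mult.commute)

text \<open>The exact degree is wanted: it has to match the number n - 1 of linear factors into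
  which f_1 specialises, for the product formula to apply.\<close>

lemma degree_f1:
  assumes "n > 0" shows "degree (f1 n) = n - 1"
proof -
  have "eval2 (gen_f n) varX = [:poly (map_poly (\<lambda>c. [:c:]) (gen_f n)) [:0, 1:]:]"
    unfolding eval2_conv_pcompose varX_def by (rule pcompose_constant)
  moreover have "eval2 (gen_f n) varY = map_poly (\<lambda>c. [:c:]) (gen_f n)"
    by (simp add: eval2_conv_pcompose varY_def pcompose_idR)
  moreover have "degree (map_poly (\<lambda>c. [:c:]) (gen_f n)) = n"
    by (subst Polynomial.degree_map_poly) (simp_all add: degree_gen_f)
  ultimately have "degree (f1 n * (varY - varX)) = n"
    using degree_add_eq_left[of "- eval2 (gen_f n) varX" "eval2 (gen_f n) varY"]
    unfolding f1_mult using assms by (simp only: diff_conv_add_uminus degree_minus degree_pCons_0)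
  moreover from this assms have "f1 n \<noteq> 0" by auto
  ultimately show ?thesis
    by (simp add: varY_minus_varX degree_mult_eq del: mult_pCons_right)
qed

text \<open>The Sylvester matrix is mapped entrywise and keeps its size, while the images may drop
  in degree. Hence the result is a \<open>resultant_sub\<close> at the original degrees.\<close>

lemma hom_resultant_sub:
  assumes "comm_ring_hom h"
  shows "h (resultant p q) = resultant_sub (degree p) (degree q) (map_poly h p) (map_poly h q)"
proof -
  interpret comm_ring_hom h by fact
  show ?thesis
    unfolding resultant_def sylvester_mat_def resultant_sub_def
    by (simp flip: hom_det add: sylvester_mat_sub_map)
qed

text \<open>Computes f_3(a, b) for roots a and b of f = (y - a)(y - b) h; the summand f(x) is absent
  because f(a) = 0. Coinciding roots are included, since the upper bound uses arbitrary
  roots.\<close>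

lemma second_difference_quotient_at_root:
  fixes a b half :: "'a::idom"
  assumes half: "half + half = 1"
    and q: "q * [:- a, 1:]\<^sup>2 = 2 * ([:- a, 1:] * [:- b, 1:] * h
      - 2 * pcompose ([:- a, 1:] * [:- b, 1:] * h) [:a * half, half:])"
  shows "poly q b = poly h ((a + b) * half)"
proof -
  define H where "H = [:a * half, half:]"
  have half': "t * half + t * half = t" for t by (metis half distrib_left mult.right_neutral)
  have half2: "half * (2 * t) = t" for t
    using half'[of t] by (simp add: mult.commute mult.left_commute flip: mult_2)
  \<comment> \<open>Substituting the midpoint (a + y)/2 for y halves y - a, so one factor y - a can
    be cancelled.\<close>
  have aH: "pcompose [:- a, 1:] H = smult half [:- a, 1:]"
    using half'[of a] by (simp add: H_def pcompose_pCons algebra_simps)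
  have two: "2 * (smult half t * u) = t * u" for t u :: "'a poly"
    by (metis half mult_2 mult_smult_left smult_add_left smult_1_left)
  have "q * [:- a, 1:] * [:- a, 1:] = 2 * ([:- b, 1:] * h - pcompose ([:- b, 1:] * h) H) * [:- a, 1:]"
    using q unfolding mult.assoc pcompose_mult[of "[:- a, 1:]"] H_def[symmetric] aH two
    by (simp only: power2_eq_square mult.assoc right_diff_distrib left_diff_distrib mult.commute mult.left_commute)
  then have q1: "q * [:- a, 1:] = 2 * ([:- b, 1:] * h - pcompose ([:- b, 1:] * h) H)"
    by (subst (asm) mult_right_cancel) simp_all
  show ?thesis
  proof (cases "a = b")
    case False
    \<comment> \<open>At y = b the first term vanishes, and the midpoint minus b equals (a -
      b)/2.\<close>
    have "poly (q * [:- a, 1:]) b = (b - a) * poly h ((a + b) * half)"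
      unfolding q1 using half'[of a] half'[of b]
      by (simp add: half2 poly_pcompose H_def algebra_simps)
    then have "(b - a) * poly q b = (b - a) * poly h ((a + b) * half)"
      by (simp add: algebra_simps)
    with False show ?thesis by simp
  next
    case True
    \<comment> \<open>Evaluation at b = a would give only 0 = 0, so the second factor y - a is
      cancelled first.\<close>
    have "q * [:- a, 1:] = (2 * h - pcompose h H) * [:- a, 1:]"
      unfolding q1 True[symmetric] right_diff_distrib pcompose_mult aH two
      by (simp only: left_diff_distrib right_diff_distrib mult.assoc mult.commute mult.left_commute)
    then have "q = 2 * h - pcompose h H"
      by (subst (asm) mult_right_cancel) simp_all
    then have "poly q b = 2 * poly h b - poly h (b * half + b * half)"
      using True by (simp add: poly_pcompose H_def)
    then show ?thesis using True half'[of b] by (simp only: distrib_right) simp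
  qed
qed

context
  fixes \<phi> :: "qmpoly \<Rightarrow> 'b::idom"
  assumes \<phi>: "comm_ring_hom \<phi>"
begin

interpretation \<phi>: comm_ring_hom \<phi> by (fact \<phi>)
interpretation \<phi>P: map_poly_comm_ring_hom \<phi> ..

text \<open>Specialising the coefficients and then setting x = a turns f_1 and f_3 into polynomials
  in y over the target ring.\<close>

lemma comm_ring_hom_poly_map_poly: "comm_ring_hom (\<lambda>p. poly (map_poly \<phi> p) a)"
  by standard (simp_all add: \<phi>P.hom_add \<phi>P.hom_mult)

lemma poly_map_poly_const: "poly (map_poly \<phi> [:c:]) a = \<phi> c"
  by (simp add: \<phi>.map_poly_pCons_hom)

lemma map_f1_mult:
  "map_poly (\<lambda>p. poly (map_poly \<phi> p) a) (f1 n) * [:- a, 1:] =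
    map_poly \<phi> (gen_f n) - [:poly (map_poly \<phi> (gen_f n)) a:]"
proof -
  let ?\<Psi> = "\<lambda>p. poly (map_poly \<phi> p) a"
  interpret \<Psi>: comm_ring_hom ?\<Psi> by (rule comm_ring_hom_poly_map_poly)
  interpret P: map_poly_comm_ring_hom ?\<Psi> ..
  have "map_poly ?\<Psi> (f1 n * (varY - varX)) = map_poly ?\<Psi> (f1 n) * [:- a, 1:]"
    unfolding P.hom_mult by (simp add: varY_minus_varX map_poly_pCons \<phi>.hom_uminus)
  then show ?thesis
    unfolding f1_mult P.hom_minus map_poly_eval2[OF comm_ring_hom_poly_map_poly]
      poly_map_poly_const
    by (simp add: varX_def varY_def map_poly_pCons pcompose_constant pcompose_idR)
qed

lemma map_f3_mult:
  "map_poly (\<lambda>p. poly (map_poly \<phi> p) a) (f3 n) * [:- a, 1:]\<^sup>2 =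
    2 * (map_poly \<phi> (gen_f n)
      - 2 * pcompose (map_poly \<phi> (gen_f n)) [:a * \<phi> (qconst (1/2)), \<phi> (qconst (1/2)):]
      + [:poly (map_poly \<phi> (gen_f n)) a:])"
proof -
  let ?\<Psi> = "\<lambda>p. poly (map_poly \<phi> p) a"
  interpret \<Psi>: comm_ring_hom ?\<Psi> by (rule comm_ring_hom_poly_map_poly)
  interpret P: map_poly_comm_ring_hom ?\<Psi> ..
  have "map_poly ?\<Psi> (f3 n * (varY - varX)\<^sup>2) = map_poly ?\<Psi> (f3 n) * [:- a, 1:]\<^sup>2"
    unfolding P.hom_mult P.hom_power by (simp add: varY_minus_varX map_poly_pCons \<phi>.hom_uminus)
  moreover have "map_poly ?\<Psi> ((varX + varY) * [:[:qconst (1/2):]:]) =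
      [:a * \<phi> (qconst (1/2)), \<phi> (qconst (1/2)):]"
    by (simp add: varX_def varY_def \<Psi>.map_poly_pCons_hom \<phi>.map_poly_pCons_hom mult.commute \<phi>.hom_mult)
  moreover have "map_poly ?\<Psi> varY = [:0, 1:]" "map_poly ?\<Psi> varX = [:a:]"
    by (simp_all add: varX_def varY_def map_poly_pCons)
  moreover have "map_poly ?\<Psi> 2 = 2" by (rule P.hom_numeral)
  ultimately show ?thesis
    unfolding f3_mult P.hom_mult P.hom_minus P.hom_add map_poly_eval2[OF comm_ring_hom_poly_map_poly]
      poly_map_poly_const
    by (simp add: pcompose_constant pcompose_idR)
qed

text \<open>The product formula is used twice: the outer resultant runs over the roots r_i of f, the
  inner one over the roots r_j, j distinct from i, of f_1(r_i, y).\<close>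

lemma hom_E_res_roots:
  assumes "n > 0" and F: "map_poly \<phi> (gen_f n) = (\<Prod>i<n. [:- r i, 1:])"
  shows "\<phi> (E_res n) = (\<Prod>i<n. \<Prod>j\<in>{..<n} - {i}. \<Prod>k\<in>{..<n} - {i} - {j}.
    (r i + r j) * \<phi> (qconst (1/2)) - r k)"
proof -
  let ?\<Psi> = "\<lambda>a p. poly (map_poly \<phi> p) a"
  let ?half = "\<phi> (qconst (1/2))"
  let ?R = "resultant (f1 n) (f3 n)"
  have half: "?half + ?half = 1" by (simp add: qconst_half flip: \<phi>.hom_add)
  have "\<phi> (E_res n) = resultant_sub n (degree ?R) (map_poly \<phi> (gen_f n)) (map_poly \<phi> ?R)"
    unfolding E_res_def hom_resultant_sub[OF \<phi>] degree_gen_f ..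
  also have "\<dots> = (\<Prod>i<n. ?\<Psi> (r i) ?R)"
    unfolding F by (rule resultant_sub_prod_linear) (rule degree_map_poly_le)
  also have "\<dots> = (\<Prod>i<n. \<Prod>j\<in>{..<n} - {i}. \<Prod>k\<in>{..<n} - {i} - {j}. (r i + r j) * ?half - r k)"
  proof (rule prod.cong[OF refl])
    fix i assume "i \<in> {..<n}"
    then have i: "i < n" by simp
    let ?I = "{..<n} - {i}"
    have Fi: "map_poly \<phi> (gen_f n) = [:- r i, 1:] * (\<Prod>j\<in>?I. [:- r j, 1:])"
      unfolding F using i by (subst prod.remove[of _ i]) auto
    have root: "poly (map_poly \<phi> (gen_f n)) (r i) = 0" by (simp add: Fi)
    have "map_poly (?\<Psi> (r i)) (f1 n) * [:- r i, 1:] = (\<Prod>j\<in>?I. [:- r j, 1:]) * [:- r i, 1:]"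
      using map_f1_mult[of "r i" n] unfolding root by (simp add: Fi mult.commute)
    then have f1: "map_poly (?\<Psi> (r i)) (f1 n) = (\<Prod>j\<in>?I. [:- r j, 1:])"
      by (subst (asm) mult_right_cancel) simp_all
    have "?\<Psi> (r i) ?R = resultant_sub (n - 1) (degree (f3 n)) (\<Prod>j\<in>?I. [:- r j, 1:]) (map_poly (?\<Psi> (r i)) (f3 n))"
      unfolding hom_resultant_sub[OF comm_ring_hom_poly_map_poly] f1 degree_f1[OF assms(1)] ..
    also have "\<dots> = (\<Prod>j\<in>?I. poly (map_poly (?\<Psi> (r i)) (f3 n)) (r j))"
      using resultant_sub_prod_linear_set[of ?I "map_poly (?\<Psi> (r i)) (f3 n)" "degree (f3 n)" r] i
      by (simp add: degree_map_poly_le)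
    also have "\<dots> = (\<Prod>j\<in>?I. \<Prod>k\<in>?I - {j}. (r i + r j) * ?half - r k)"
    proof (rule prod.cong[OF refl])
      fix j assume j: "j \<in> ?I"
      let ?h = "\<Prod>k\<in>?I - {j}. [:- r k, 1:]"
      have Fij: "map_poly \<phi> (gen_f n) = [:- r i, 1:] * [:- r j, 1:] * ?h"
        unfolding Fi mult.assoc using j by (subst prod.remove[of _ j]) auto
      have "poly (map_poly (?\<Psi> (r i)) (f3 n)) (r j) = poly ?h ((r i + r j) * ?half)"
        using map_f3_mult[of "r i" n] unfolding root
        by (intro second_difference_quotient_at_root[OF half]) (simp only: Fij, simp)
      then show "poly (map_poly (?\<Psi> (r i)) (f3 n)) (r j) = (\<Prod>k\<in>?I - {j}. (r i + r j) * ?half - r k)"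
        by (simp add: poly_prod)
    qed
    finally show "?\<Psi> (r i) ?R = \<dots>" .
  qed
  finally show ?thesis .
qed

lemma map_poly_gen_f_eqI:
  assumes "degree p = n" "monic p" "\<And>i. i < n \<Longrightarrow> \<phi> (avar i) = coeff p i"
  shows "map_poly \<phi> (gen_f n) = p"
  using assms by (auto simp: poly_eq_iff coeff_gen_f coeff_eq_0)

end

text \<open>The defining equations of f_1 and f_3 have right sides and divisors fixed by the
  homomorphism; cancelling the divisor shows that the quotients are fixed, and then so are the
  resultants.\<close>

lemma hom_E_res_fixed:
  assumes "comm_ring_hom \<phi>" "\<And>i. i < n \<Longrightarrow> \<phi> (avar i) = avar i" "\<phi> (qconst (1/2)) = qconst (1/2)"
  shows "\<phi> (E_res n) = E_res n"
proof -
  interpret \<phi>: comm_ring_hom \<phi> by fact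
  interpret \<phi>P: map_poly_comm_ring_hom \<phi> ..
  interpret \<phi>PP: map_poly_comm_ring_hom "map_poly \<phi>" ..
  have f: "map_poly \<phi> (gen_f n) = gen_f n"
    using assms(2) by (auto simp: poly_eq_iff coeff_gen_f)
  have eval2: "map_poly (map_poly \<phi>) (eval2 (gen_f n) t) = eval2 (gen_f n) (map_poly (map_poly \<phi>) t)" for t
  proof -
    have "map_poly (\<lambda>c. map_poly \<phi> [:c:]) (gen_f n) = map_poly (\<lambda>c. [:c:]) (map_poly \<phi> (gen_f n))"
      by (auto simp: poly_eq_iff coeff_map_poly coeff_pCons split: nat.splits)
    then show ?thesis
      unfolding map_poly_eval2[OF \<phi>P.comm_ring_hom_axioms] by (simp add: f eval2_conv_pcompose)
  qed
  have XY: "map_poly (map_poly \<phi>) varX = varX" "map_poly (map_poly \<phi>) varY = varY"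
    "map_poly (map_poly \<phi>) [:[:qconst (1/2):]:] = [:[:qconst (1/2):]:]"
    by (simp_all add: varX_def varY_def \<phi>P.map_poly_pCons_hom \<phi>.map_poly_pCons_hom assms(3))
  have "map_poly (map_poly \<phi>) (f1 n * (varY - varX)) = f1 n * (varY - varX)"
    unfolding f1_mult \<phi>PP.hom_minus eval2 XY ..
  then have f1: "map_poly (map_poly \<phi>) (f1 n) = f1 n"
    unfolding \<phi>PP.hom_mult \<phi>PP.hom_minus XY
    by (simp only: mult_right_cancel[OF varY_minus_varX_nz])
  have two: "map_poly (map_poly \<phi>) 2 = 2" by (rule \<phi>PP.hom_numeral)
  have "map_poly (map_poly \<phi>) (f3 n * (varY - varX)\<^sup>2) = f3 n * (varY - varX)\<^sup>2"
    unfolding f3_mult \<phi>PP.hom_minus \<phi>PP.hom_add \<phi>PP.hom_mult eval2 XY two ..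
  then have f3: "map_poly (map_poly \<phi>) (f3 n) = f3 n"
    unfolding \<phi>PP.hom_mult \<phi>PP.hom_minus \<phi>PP.hom_power XY
    by (simp only: mult_right_cancel[OF power_not_zero[OF varY_minus_varX_nz]])
  have R: "map_poly \<phi> (resultant (f1 n) (f3 n)) = resultant (f1 n) (f3 n)"
    using \<phi>P.resultant_map_poly[of "f1 n" "f3 n"] by (simp add: f1 f3)
  show ?thesis
    using \<phi>.resultant_map_poly[of "gen_f n" "resultant (f1 n) (f3 n)"]
    by (simp add: E_res_def f R)
qed

subsection \<open>The degree in one root\<close>

lemma monic_complex_factorization:
  fixes g :: "complex poly"
  assumes "monic g"
  obtains s where "g = (\<Prod>l<degree g. [:- s l, 1:])"
proof -
  from assms have "g \<noteq> 0" by auto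
  from alg_closed_imp_factorization[OF this] obtain A
    where A: "size A = degree g" "g = (\<Prod>x\<in>#A. [:- x, 1:])" using assms by auto
  obtain xs where xs: "mset xs = A" using ex_mset by blast
  have "g = prod_list (map (\<lambda>x. [:- x, 1:]) xs)"
    using A(2) xs by (metis mset_map prod_mset_prod_list)
  also have "\<dots> = (\<Prod>l<degree g. [:- (xs ! l), 1:])"
    using A(1) xs by (auto simp: prod.list_conv_set_nth atLeast0LessThan)
  finally show thesis using that by blast
qed

text \<open>The value of E at the monic polynomial with roots r_0, ..., r_{n-1} in C[t].\<close>

definition midpoint_prod :: "(nat \<Rightarrow> complex poly) \<Rightarrow> nat \<Rightarrow> complex poly" where
  "midpoint_prod r n = (\<Prod>i<n. \<Prod>j\<in>{..<n} - {i}. \<Prod>k\<in>{..<n} - {i} - {j}.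
    (r i + r j) * [:1/2:] - r k)"

text \<open>The first index 0 leaves (n-1)(n-2) choices. Each of the n - 1 other first indices gives
  n - 2 triples with j = 0 and n - 2 with k = 0.\<close>

lemma count_triples_with_0:
  fixes n :: nat
  assumes "n \<ge> 3"
  shows "(\<Sum>i<n. \<Sum>j\<in>{..<n} - {i}. \<Sum>k\<in>{..<n} - {i} - {j}. if i = 0 \<or> j = 0 \<or> k = 0 then 1 else 0 :: nat)
    = 3 * (n - 1) * (n - 2)" (is "(\<Sum>i<n. ?S i) = _")
proof -
  have S0: "?S 0 = (n - 1) * (n - 2)"
  proof -
    have "?S 0 = (\<Sum>j\<in>{..<n} - {0}. n - 2)"
      using assms by (intro sum.cong) (auto simp: card_Diff_singleton)
    then show ?thesis using assms by simp
  qed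
  have Si: "?S i = 2 * (n - 2)" if "i \<in> {..<n} - {0}" for i
  proof -
    have "(\<Sum>k\<in>{..<n} - {i} - {j}. if i = 0 \<or> j = 0 \<or> k = 0 then 1 else 0 :: nat) = 1"
      if "j \<in> {..<n} - {i} - {0}" for j
    proof -
      have "(\<Sum>k\<in>{..<n} - {i} - {j}. if i = 0 \<or> j = 0 \<or> k = 0 then 1 else 0 :: nat)
        = (\<Sum>k\<in>{..<n} - {i} - {j}. if k = 0 then 1 else 0)"
        using \<open>i \<in> _\<close> that by (intro sum.cong) auto
      also have "\<dots> = 1" using \<open>i \<in> _\<close> that assms by (subst sum.delta) auto
      finally show ?thesis .
    qed
    moreover have "(\<Sum>k\<in>{..<n} - {i} - {0}. if i = 0 \<or> 0 = 0 \<or> k = 0 then 1 else 0 :: nat) = n - 2"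
      using that assms by (simp add: card_Diff_singleton)
    ultimately have "?S i = (n - 2) + (\<Sum>j\<in>{..<n} - {i} - {0}. 1)"
      using that assms by (subst sum.remove[of _ 0]) auto
    also have "(\<Sum>j\<in>{..<n} - {i} - {0}. 1) = n - 2"
      using that assms by (simp add: card_Diff_singleton)
    finally show ?thesis by simp
  qed
  have "(\<Sum>i<n. ?S i) = ?S 0 + (\<Sum>i\<in>{..<n} - {0}. ?S i)"
    using assms by (subst sum.remove[of _ 0]) auto
  also have "(\<Sum>i\<in>{..<n} - {0}. ?S i) = (\<Sum>i\<in>{..<n} - {0}. 2 * (n - 2))"
    by (rule sum.cong[OF refl Si])
  also have "?S 0 + \<dots> = 3 * (n - 1) * (n - 2)"
    unfolding S0 using assms by simp
  finally show ?thesis .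
qed

context
  fixes s :: "nat \<Rightarrow> complex" and r :: "nat \<Rightarrow> complex poly"
  assumes r0: "r 0 = [:0, 1:]" and rSuc: "\<And>l. r (Suc l) = [:s l:]"
begin

text \<open>The indices being distinct, the root t occurs at most once, with coefficient 1/2 or -1,
  and cannot cancel.\<close>

lemma degree_midpoint_factor:
  assumes "j \<noteq> i" "k \<noteq> i" "k \<noteq> j"
  shows "degree ((r i + r j) * [:1/2:] - r k) = (if i = 0 \<or> j = 0 \<or> k = 0 then 1 else 0)"
  using assms by (cases i; cases j; cases k) (auto simp: r0 rSuc)

lemma degree_midpoint_prod_le:
  assumes "n \<ge> 3"
  shows "degree (midpoint_prod r n) \<le> 3 * (n - 1) * (n - 2)"
proof -
  have "degree (midpoint_prod r n) \<le> (\<Sum>i<n. \<Sum>j\<in>{..<n} - {i}. \<Sum>k\<in>{..<n} - {i} - {j}.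
      degree ((r i + r j) * [:1/2:] - r k))"
    unfolding midpoint_prod_def
    by (intro order.trans[OF degree_prod_sum_le[unfolded o_def]] sum_mono finite_Diff finite_lessThan)
      (rule order.refl)
  also have "\<dots> = (\<Sum>i<n. \<Sum>j\<in>{..<n} - {i}. \<Sum>k\<in>{..<n} - {i} - {j}. if i = 0 \<or> j = 0 \<or> k = 0 then 1 else 0)"
    by (intro sum.cong refl degree_midpoint_factor) auto
  finally show ?thesis unfolding count_triples_with_0[OF assms] .
qed

text \<open>Degrees add up once no factor is zero: factors containing t have degree 1, and the
  constant ones are nonzero because no s_k is the midpoint of two others.\<close>

lemma degree_midpoint_prod:
  assumes "n \<ge> 3" and s: "\<And>i j k. j \<noteq> i \<Longrightarrow> k \<noteq> i \<Longrightarrow> k \<noteq> j \<Longrightarrow> s i + s j \<noteq> 2 * s k"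
  shows "degree (midpoint_prod r n) = 3 * (n - 1) * (n - 2)"
proof -
  have nz: "(r i + r j) * [:1/2:] - r k \<noteq> 0" if "j \<noteq> i" "k \<noteq> i" "k \<noteq> j" for i j k
  proof (cases "i = 0 \<or> j = 0 \<or> k = 0")
    case True
    with degree_midpoint_factor[OF that] show ?thesis by (metis degree_0 zero_neq_one)
  next
    case False
    then obtain i' j' k' where ijk: "i = Suc i'" "j = Suc j'" "k = Suc k'" by (meson not0_implies_Suc)
    have "s i' + s j' \<noteq> 2 * s k'" using that by (intro s) (auto simp: ijk)
    then have "(s i' + s j') * (1/2) \<noteq> s k'" by (auto simp: field_simps)
    then show ?thesis by (simp add: rSuc ijk)
  qed
  then have nz': "(r i + r j) * [:1/2:] \<noteq> r k" if "j \<noteq> i" "k \<noteq> i" "k \<noteq> j" for i j k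
    using that by (metis right_minus_eq)
  have "degree (midpoint_prod r n) = (\<Sum>i<n. degree (\<Prod>j\<in>{..<n} - {i}. \<Prod>k\<in>{..<n} - {i} - {j}.
      (r i + r j) * [:1/2:] - r k))"
    unfolding midpoint_prod_def by (rule degree_prod_eq_sum_degree) (auto simp: nz' simp del: mult_pCons_right)
  also have "\<dots> = (\<Sum>i<n. \<Sum>j\<in>{..<n} - {i}. degree (\<Prod>k\<in>{..<n} - {i} - {j}.
      (r i + r j) * [:1/2:] - r k))"
    by (rule sum.cong[OF refl], rule degree_prod_eq_sum_degree) (auto simp: nz' simp del: mult_pCons_right)
  also have "\<dots> = (\<Sum>i<n. \<Sum>j\<in>{..<n} - {i}. \<Sum>k\<in>{..<n} - {i} - {j}.
      degree ((r i + r j) * [:1/2:] - r k))"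
    by (rule sum.cong[OF refl], rule sum.cong[OF refl], rule degree_prod_eq_sum_degree)
      (auto simp: nz' simp del: mult_pCons_right)
  also have "\<dots> = (\<Sum>i<n. \<Sum>j\<in>{..<n} - {i}. \<Sum>k\<in>{..<n} - {i} - {j}. if i = 0 \<or> j = 0 \<or> k = 0 then 1 else 0)"
    by (intro sum.cong refl degree_midpoint_factor) auto
  finally show ?thesis unfolding count_triples_with_0[OF assms(1)] .
qed

end

section \<open>Specialising one root to t, and the two bounds\<close>

lemma const_of_rat_hom: "comm_ring_hom (\<lambda>x. [:of_rat x :: 'a::field_char_0:])"
  by standard (simp_all add: of_rat_add of_rat_mult flip: one_pCons)

lemma monic_prod_linear: "degree (\<Prod>i<n. [:- r i, 1:]) = n" "monic (\<Prod>i<n. [:- r i, 1:])"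
  for r :: "nat \<Rightarrow> 'a::idom"
proof -
  have "coeff (\<Prod>i<n. [:- r i, 1:]) n = 1"
    using coeff_newton_poly_ge[of n n r] by (simp add: newton_poly_def)
  moreover have "degree (\<Prod>i<n. [:- r i, 1:]) \<le> n"
    using degree_newton_poly_le[of r n] by (simp add: newton_poly_def)
  ultimately show "degree (\<Prod>i<n. [:- r i, 1:]) = n" "monic (\<Prod>i<n. [:- r i, 1:])"
    by (metis le_antisym le_degree zero_neq_one)+
qed

lemma E_res_specialisation:
  fixes s :: "nat \<Rightarrow> complex" and n :: nat
  assumes "n \<ge> 1"
  defines "r \<equiv> case_nat [:0, 1:] (\<lambda>l. [:s l:])" and "g \<equiv> \<Prod>l<n - 1. [:- s l, 1:]"
  obtains c where "mp_eval (\<lambda>x. [:of_rat x:]) c (E_res n) = midpoint_prod r n"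
    "\<And>i. degree (c i) \<le> 1" "\<And>i. coeff (c i) 1 = - coeff g i"
proof -
  let ?\<kappa> = "\<lambda>x. [:of_rat x :: complex:]"
  define F where "F = (\<Prod>i<n. [:- r i, 1:])"
  define c where "c i = coeff F i" for i
  obtain n' where n: "n = Suc n'" using assms(1) by (cases n) auto
  interpret C: map_poly_comm_ring_hom "\<lambda>x::complex. [:x:]" by standard simp_all
  have "map_poly (\<lambda>x. [:x:]) g = (\<Prod>l<n'. [:-[:s l:], 1:])"
    by (simp add: g_def n C.hom_prod map_poly_pCons flip: one_pCons)
  then have F: "F = [:-[:0, 1:], 1:] * map_poly (\<lambda>x. [:x:]) g"
    unfolding F_def n by (subst prod.lessThan_Suc_shift) (simp add: r_def)
  \<comment> \<open>Multiplying g by x - t gives the coefficients g_{i-1} - t g_i, linear in t, with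
    g_{-1} read as 0.\<close>
  have c: "c i = (case i of 0 \<Rightarrow> 0 | Suc i' \<Rightarrow> [:coeff g i':]) - [:0, coeff g i:]" for i
    unfolding c_def F by (cases i) (simp_all add: coeff_map_poly)
  have "map_poly (mp_eval ?\<kappa> c) (gen_f n) = F"
    using monic_prod_linear[of r n]
    by (intro map_poly_gen_f_eqI[OF comm_ring_hom_mp_eval[OF const_of_rat_hom]])
      (auto simp: F_def c_def mp_eval_avar[OF const_of_rat_hom])
  then have "mp_eval ?\<kappa> c (E_res n) = midpoint_prod r n"
    using hom_E_res_roots[OF comm_ring_hom_mp_eval[OF const_of_rat_hom], of n c r] assms(1)
    by (simp add: F_def midpoint_prod_def mp_eval_qconst[OF const_of_rat_hom] of_rat_divide
        del: mult_pCons_right)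
  moreover have "degree (c i) \<le> 1" for i unfolding c
    by (rule degree_diff_le) (auto split: nat.split)
  moreover have "coeff (c i) 1 = - coeff g i" for i
    unfolding c by (auto split: nat.split)
  ultimately show thesis using that by blast
qed

text \<open>The substitution sending a_i to 0 for i \<ge> n fixes E.\<close>

lemma keys_E_res:
  assumes "m \<in> Poly_Mapping.keys (E_res n)"
  shows "Poly_Mapping.keys m \<subseteq> {..<n}"
  by (rule keys_subset_if_mp_eval_fixed[OF _ assms], rule hom_E_res_fixed)
    (simp_all add: comm_ring_hom_mp_eval mp_eval_avar mp_eval_qconst qconst_hom)

text \<open>A substitution linear in t gives degree in t at most the total degree, so one choice of
  constant roots with no vanishing factor suffices.\<close>

lemma total_degree_E_res_ge:
  assumes "n \<ge> 3"
  shows "3 * (n - 1) * (n - 2) \<le> total_degree (E_res n)"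
proof -
  \<comment> \<open>Powers of 3 contain no three-term arithmetic progression.\<close>
  define s :: "nat \<Rightarrow> complex" where "s l = 3 ^ l" for l
  define r where "r = case_nat [:0, 1:] (\<lambda>l. [:s l:])"
  \<comment> \<open>For j \<le> k the left side is too small; for k < j already 3^j \<ge> 3 * 3^k is
    too large.\<close>
  have lt: "3 ^ i + 3 ^ j \<noteq> (2 * 3 ^ k :: nat)" if "i < j" for i j k :: nat
  proof (cases "j \<le> k")
    case True
    have "(3::nat) ^ i < 3 ^ j" "(3::nat) ^ j \<le> 3 ^ k" using that True by (auto intro: power_increasing)
    then show ?thesis by linarith
  next
    case False
    then obtain j' where j: "j = Suc j'" "k \<le> j'" by (cases j) auto
    have "(3::nat) ^ k \<le> 3 ^ j'" using j by (auto intro: power_increasing)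
    moreover have "(3::nat) ^ i > 0" by simp
    ultimately show ?thesis unfolding j(1) power_Suc by linarith
  qed
  have s: "s i + s j \<noteq> 2 * s k" if "j \<noteq> i" for i j k
  proof -
    have "3 ^ i + 3 ^ j \<noteq> (2 * 3 ^ k :: nat)"
      using that lt[of i j k] lt[of j i k] by (metis add.commute linorder_neqE_nat)
    then have "of_nat (3 ^ i + 3 ^ j) \<noteq> (of_nat (2 * 3 ^ k) :: complex)"
      by (simp only: of_nat_eq_iff not_False_eq_True)
    then show ?thesis by (simp add: s_def)
  qed
  obtain c where c: "mp_eval (\<lambda>x. [:of_rat x:]) c (E_res n) = midpoint_prod r n" "\<And>i. degree (c i) \<le> 1"
    using E_res_specialisation[of n s] assms unfolding r_def by (metis order.trans one_le_numeral)
  have "degree (midpoint_prod r n) = 3 * (n - 1) * (n - 2)"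
    by (rule degree_midpoint_prod[of r s]) (use assms s in \<open>auto simp: r_def\<close>)
  then show ?thesis
    using mp_eval_linear(1)[of c "E_res n", OF c(2)] by (simp add: c(1))
qed

lemma total_degree_E_res_le:
  assumes n3: "n \<ge> 3"
  shows "total_degree (E_res n) \<le> 3 * (n - 1) * (n - 2)"
proof (rule ccontr)
  assume not: "\<not> ?thesis"
  define D where "D = total_degree (E_res n)"
  define K where "K = {m. m \<in> Poly_Mapping.keys (E_res n) \<and> mon_deg m = D}"
  define \<alpha> where "\<alpha> m = (of_rat (Poly_Mapping.lookup (E_res n) m) :: complex)" for m
  obtain n' where n: "n = Suc n'" using n3 by (cases n) auto
  \<comment> \<open>The assumed excess makes D positive, so D is the degree of an actual monomial
    and not the default 0.\<close>
  obtain m0 where "m0 \<in> K"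
    using total_degree_attained[of "E_res n"] not by (auto simp: K_def D_def)
  moreover have "finite K" unfolding K_def by simp
  moreover have "Poly_Mapping.keys m \<subseteq> {..<Suc n'} \<and> mon_deg m = D \<and> \<alpha> m \<noteq> 0" if "m \<in> K" for m
    using that keys_E_res[of m n] by (auto simp: K_def \<alpha>_def n in_keys_iff)
  \<comment> \<open>The value -1 in the last coordinate makes the polynomial g with coefficients
    -b_i monic, so it splits over the complex numbers.\<close>
  ultimately obtain b where b: "b n' = - 1" "(\<Sum>m\<in>K. \<alpha> m * mon_eval b m) \<noteq> 0"
    using homogeneous_nonvanishing_point[of K "- 1" n' D \<alpha>] by auto
  define g where "g = (\<Sum>i\<le>n'. monom (- b i) i)"
  have coeff_g: "coeff g i = (if i \<le> n' then - b i else 0)" for i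
    by (auto simp: g_def coeff_sum)
  have deg_g: "degree g = n'"
    by (rule antisym[OF degree_le le_degree]) (auto simp: coeff_g b(1))
  have "monic g" by (simp add: deg_g coeff_g b(1))
  then obtain s where s: "g = (\<Prod>l<n'. [:- s l, 1:])"
    using monic_complex_factorization[of g] unfolding deg_g by blast
  define r where "r = case_nat [:0, 1:] (\<lambda>l. [:s l:])"
  obtain c where c: "mp_eval (\<lambda>x. [:of_rat x:]) c (E_res n) = midpoint_prod r n" "\<And>i. degree (c i) \<le> 1"
    "\<And>i. coeff (c i) 1 = - coeff g i"
    using E_res_specialisation[of n s] n3 s unfolding r_def n by auto
  have "coeff (midpoint_prod r n) D = (\<Sum>m\<in>K. \<alpha> m * mon_eval (\<lambda>i. coeff (c i) 1) m)"
    using mp_eval_linear(2)[of c "E_res n", OF c(2)] by (simp add: c(1) D_def K_def \<alpha>_def)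
  also have "\<dots> = (\<Sum>m\<in>K. \<alpha> m * mon_eval b m)"
  proof (rule sum.cong[OF refl])
    fix m assume "m \<in> K"
    \<comment> \<open>The t-coefficients -g_i agree with b_i only for i < n, which covers every
      indeterminate in E.\<close>
    then have "Poly_Mapping.keys m \<subseteq> {..<n}" by (simp add: K_def keys_E_res)
    then have "mon_eval (\<lambda>i. coeff (c i) 1) m = mon_eval b m"
      by (intro mon_eval_cong) (auto simp: c(3)[unfolded One_nat_def] coeff_g n)
    then show "\<alpha> m * mon_eval (\<lambda>i. coeff (c i) 1) m = \<alpha> m * mon_eval b m" by simp
  qed
  \<comment> \<open>The coefficient of t^D is the top part of E at b, which is nonzero.\<close>
  finally have "D \<le> degree (midpoint_prod r n)" using b(2) by (intro le_degree) simp
  also have "\<dots> \<le> 3 * (n - 1) * (n - 2)"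
    by (rule degree_midpoint_prod_le[of r s]) (use n3 in \<open>auto simp: r_def\<close>)
  finally show False using not by (simp add: D_def)
qed

theorem corollary3:
  fixes n :: nat
  assumes "n \<ge> 3"
  shows "total_degree (E_res n) = 3 * (n - 1) * (n - 2)"
  using total_degree_E_res_ge[OF assms] total_degree_E_res_le[OF assms] by (rule antisym[rotated])

end
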